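(* Let $\mathcal H$ be a real Hilbert space and let $A:\mathcal H\to 2^{\mathcal H}$ be a maximally monotone operator with $S=A^{-1}(0)\ne\emptyset$. Suppose there is $\nu>0$ such that, for all $x\in\mathcal H$, all $x^*\in Ax$ and all $z\in S$, $$\langle x^*,x-z\rangle\ge\nu\,\mathrm{dist}(x,S)^2.$$ Let $t_0>0$, $\alpha>2$ and $\lambda(t)=(1+\epsilon)\frac{t^2}{\alpha^2}$ with $\epsilon>\frac{2}{\alpha-2}$, and let $x:[t_0,+\infty[\to\mathcal H$ be a solution of $$\ddot x(t)+\frac{\alpha}{t}\dot x(t)+A_{\lambda(t)}(x(t))=0.$$ Then $\lim_{t\to+\infty}\mathrm{dist}(x(t),S)=0$. If, moreover, $S=\{\bar z\}$, then $x(t)$ converges strongly to $\bar z$ as $t\to+\infty$.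
   Context: For $\lambda>0$, $A_\lambda=\frac1\lambda\left(I-(I+\lambda A)^{-1}\right)$ is the Yosida regularization of $A$ with index $\lambda$. $S=A^{-1}(0)=\{z\in\mathcal H:0\in Az\}$ and $\mathrm{dist}(x,S)=\inf_{z\in S}\|x-z\|$. A solution is a classical ($C^2$) solution on $[t_0,+\infty[$. *)

theory Defs
  imports "HOL-Analysis.Analysis"
begin

text \<open>
  A real Hilbert space is a type of sort \<open>{real_inner, complete_space}\<close>.
  A set-valued operator on it is a function \<open>'a \<Rightarrow> 'a set\<close>.
\<close>

definition op_inverse :: "('a \<Rightarrow> 'b set) \<Rightarrow> 'b \<Rightarrow> 'a set" where
  "op_inverse A u = {z. u \<in> A z}"

definition monotone_operator :: "('a::real_inner \<Rightarrow> 'a set) \<Rightarrow> bool" where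
  "monotone_operator A \<longleftrightarrow>
     (\<forall>x y. \<forall>u\<in>A x. \<forall>v\<in>A y. 0 \<le> (x - y) \<bullet> (u - v))"

text \<open>Maximality is with respect to inclusion of graphs.\<close>

definition maximally_monotone :: "('a::real_inner \<Rightarrow> 'a set) \<Rightarrow> bool" where
  "maximally_monotone A \<longleftrightarrow>
     monotone_operator A \<and>
     (\<forall>B. monotone_operator B \<and> (\<forall>x. A x \<subseteq> B x) \<longrightarrow> B = A)"

definition zeros :: "('a \<Rightarrow> 'b::zero set) \<Rightarrow> 'a set" where
  "zeros A = op_inverse A 0"

text \<open>
  The set-valued inverse of \<open>I + \<lambda>A\<close>, read as a function. For maximally monotone \<open>A\<close>
  and \<open>\<lambda> > 0\<close> its values are singletons (Minty), so the description is proper.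
\<close>

definition resolvent :: "real \<Rightarrow> ('a::real_inner \<Rightarrow> 'a set) \<Rightarrow> 'a \<Rightarrow> 'a" where
  "resolvent l A x = (THE y. y \<in> op_inverse (\<lambda>y. {y + l *\<^sub>R u | u. u \<in> A y}) x)"

definition yosida :: "real \<Rightarrow> ('a::real_inner \<Rightarrow> 'a set) \<Rightarrow> 'a \<Rightarrow> 'a" where
  "yosida l A x = (1 / l) *\<^sub>R (x - resolvent l A x)"

text \<open>
  Classical solutions on \<open>[t0, \<infinity>)\<close> of
  \<open>x''(t) + (\<alpha> / t) x'(t) + A\<^bsub>l(t)\<^esub>(x(t)) = 0\<close>.
  Derivatives at \<open>t0\<close> are one-sided; values of \<open>x\<close> below \<open>t0\<close> are irrelevant.
\<close>

definition classical_solution ::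
  "real \<Rightarrow> real \<Rightarrow> (real \<Rightarrow> real) \<Rightarrow> ('a::real_inner \<Rightarrow> 'a set) \<Rightarrow> (real \<Rightarrow> 'a) \<Rightarrow> bool" where
  "classical_solution t0 \<alpha> l A x \<longleftrightarrow>
     (\<exists>x' x''.
        (\<forall>t\<ge>t0. (x has_vector_derivative x' t) (at t within {t0..})) \<and>
        (\<forall>t\<ge>t0. (x' has_vector_derivative x'' t) (at t within {t0..})) \<and>
        continuous_on {t0..} x'' \<and>
        (\<forall>t\<ge>t0. x'' t + (\<alpha> / t) *\<^sub>R x' t + yosida (l t) A (x t) = 0))"

end

theory Submission
  imports Defs
begin

text \<open>
  Write \<open>u(t)\<close> for the Yosida term, \<open>J(t)\<close> for the resolvent at \<open>x(t)\<close>, and fix a zero \<open>z\<close>.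
  Since \<open>x = J + \<lambda> u\<close> with \<open>u \<in> A J\<close>, the growth hypothesis at \<open>J\<close> says
  \[ \langle u, x - z \rangle \ge \nu\, dist(J,S)^2 + \lambda \|u\|^2 . \]
  This needs the resolvent to be defined everywhere, that is, Minty's theorem. It is obtained
  in \<open>minty_graph\<close> by minimising the Fitzpatrick function plus half the squared norm;
  completeness enters only there, through \<open>regularised_epigraph_minimiser\<close>.

  Put \<open>\<kappa> = (1 + \<epsilon>) / \<alpha>\<close>, so that \<open>\<lambda>(t) = \<kappa> t\<^sup>2 / \<alpha>\<close>. The energy
  \[ W(t) = t \langle x - z, x' \rangle + \frac{\alpha-1}{2} \|x - z\|^2 + \kappa t^2 \|x'\|^2 \]
  then satisfies (\<open>energy_has_derivative\<close>, \<open>energy_dissipation\<close>)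
  \[ W' \le - t \Bigl( \nu\, dist(J,S)^2 + (\kappa\alpha - 1 - 2\kappa) \|x'\|^2
       + \kappa\alpha \|x' + \frac{t}{\alpha} u\|^2 \Bigr) . \]
  The condition on \<open>\<epsilon>\<close> is exactly the positivity of \<open>\<kappa>\<alpha> - 1 - 2\<kappa>\<close>, and it also makes \<open>W\<close> a positive
  definite quadratic form in \<open>(x - z, t x')\<close>. Hence \<open>W\<close> is nonincreasing and \<open>t \<parallel>x'\<parallel>\<close> is bounded.

  The distance from \<open>x\<close> to \<open>J\<close> is \<open>\<lambda> \<parallel>u\<parallel>\<close>, which is \<open>\<kappa> t\<close> times the norm of \<open>(t / \<alpha>) u\<close>. So all
  terms of the dissipation together dominate \<open>c dist(x,S)\<^sup>2 / t\<close> for some \<open>c > 0\<close>. In the time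
  variable \<open>ln t\<close> the distance is therefore square integrable, and it is Lipschitz because
  \<open>t \<parallel>x'\<parallel>\<close> is bounded; Barbalat's argument (\<open>log_lipschitz_tendsto_0\<close>) makes it tend to \<open>0\<close>.
\<close>

section \<open>Maximal monotonicity and Minty's theorem\<close>

lemma maximally_monotoneD:
  assumes "maximally_monotone A" "u \<in> A x" "v \<in> A y"
  shows "0 \<le> (x - y) \<bullet> (u - v)"
  using assms unfolding maximally_monotone_def monotone_operator_def by blast

lemma maximally_monotone_memI:
  assumes A: "maximally_monotone A" and rel: "\<And>y v. v \<in> A y \<Longrightarrow> 0 \<le> (a - y) \<bullet> (b - v)"
  shows "b \<in> A a"
proof -
  let ?B = "A(a := insert b (A a))"
  have rel': "0 \<le> (y - a) \<bullet> (v - b)" if "v \<in> A y" for y v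
    using rel[OF that] by (simp add: inner_diff_left inner_diff_right)
  have "monotone_operator ?B"
    unfolding monotone_operator_def
    using maximally_monotoneD[OF A] rel rel' by (auto simp: fun_upd_def)
  moreover have "\<forall>x. A x \<subseteq> ?B x" by auto
  ultimately have "?B = A"
    using A unfolding maximally_monotone_def by blast
  then show ?thesis by (metis fun_upd_same insertI1)
qed

text \<open>
  The set \<open>E\<close> plays the epigraph of a convex lower semicontinuous function \<open>F\<close>, which may be infinite
  at some points. Adding half the squared norm makes minimising sequences Cauchy, by the
  parallelogram law. The conclusion is the optimality condition \<open>- w0 \<in> \<partial>F(w0)\<close>.
\<close>
lemma regularised_epigraph_minimiser:
  fixes E :: "('b::{real_inner,complete_space} \<times> real) set"
  assumes "closed E" "convex E" "E \<noteq> {}"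
    and lb: "\<And>w r. (w, r) \<in> E \<Longrightarrow> 0 \<le> r + w \<bullet> w / 2"
  obtains w0 r0 where "(w0, r0) \<in> E" "\<And>w r. (w, r) \<in> E \<Longrightarrow> r0 + w0 \<bullet> w0 \<le> r + w0 \<bullet> w"
proof -
  define V where "V = (\<lambda>p :: 'b \<times> real. snd p + fst p \<bullet> fst p / 2)"
  define m where "m = Inf (V ` E)"
  have bdd: "bdd_below (V ` E)"
    using lb by (intro bdd_belowI[of _ 0]) (auto simp: V_def)
  have m_le: "m \<le> V p" if "p \<in> E" for p
    unfolding m_def using bdd that by (rule cINF_lower)
  have "\<exists>p\<in>E. V p < m + 1 / Suc n" for n
    using cInf_lessD[of "V ` E" "m + 1 / Suc n"] \<open>E \<noteq> {}\<close> unfolding m_def by auto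
  then obtain p where pE: "\<And>n. p n \<in> E" and pV: "\<And>n. V (p n) < m + 1 / Suc n" by metis
  have V_mid: "V ((1/2) *\<^sub>R a + (1/2) *\<^sub>R b) = (V a + V b) / 2 - (norm (fst a - fst b))\<^sup>2 / 8" for a b
    by (simp add: V_def power2_norm_eq_inner inner_add_left inner_add_right inner_diff_left
        inner_diff_right inner_commute field_simps)
  have dist_le: "(dist (fst (p i)) (fst (p j)))\<^sup>2 \<le> 4 * (1 / Suc i + 1 / Suc j)" for i j
  proof -
    have "(1/2) *\<^sub>R p i + (1/2) *\<^sub>R p j \<in> E"
      using \<open>convex E\<close> pE by (intro convexD) auto
    from m_le[OF this]
    have "(dist (fst (p i)) (fst (p j)))\<^sup>2 / 8 \<le> (V (p i) + V (p j)) / 2 - m"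
      unfolding V_mid dist_norm by argo
    also have "\<dots> \<le> (1 / Suc i + 1 / Suc j) / 2"
      using pV[of i] pV[of j] by argo
    finally show ?thesis by argo
  qed
  have "Cauchy (\<lambda>n. fst (p n))"
  proof (rule metric_CauchyI)
    fix e :: real assume "0 < e"
    then obtain N where N: "1 / Suc N < e\<^sup>2 / 8"
      using nat_approx_posE[of "e\<^sup>2 / 8"] by (auto simp: inverse_eq_divide)
    have "dist (fst (p i)) (fst (p j)) < e" if "i \<ge> N" "j \<ge> N" for i j
    proof -
      have "1 / real (Suc i) \<le> 1 / Suc N" "1 / real (Suc j) \<le> 1 / Suc N"
        using that by (auto intro!: divide_left_mono)
      then have "(dist (fst (p i)) (fst (p j)))\<^sup>2 < e\<^sup>2"
        using dist_le[of i j] N by argo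
      then show ?thesis using \<open>0 < e\<close> by (simp add: power_less_imp_less_base)
    qed
    then show "\<exists>N. \<forall>i\<ge>N. \<forall>j\<ge>N. dist (fst (p i)) (fst (p j)) < e" by blast
  qed
  then obtain w0 where w0: "(\<lambda>n. fst (p n)) \<longlonglongrightarrow> w0"
    using Cauchy_convergent convergent_def by blast
  have "(\<lambda>n. V (p n)) \<longlonglongrightarrow> m"
  proof (rule tendsto_sandwich)
    show "\<forall>\<^sub>F n in sequentially. m \<le> V (p n)"
      using m_le[OF pE] by simp
    show "\<forall>\<^sub>F n in sequentially. V (p n) \<le> m + 1 / real (Suc n)"
      using pV by (intro always_eventually allI less_imp_le)
    show "(\<lambda>n. m + 1 / real (Suc n)) \<longlonglongrightarrow> m"
      using LIMSEQ_inverse_real_of_nat_add[of m] by (simp add: inverse_eq_divide)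
  qed simp
  then have "(\<lambda>n. V (p n) - fst (p n) \<bullet> fst (p n) / 2) \<longlonglongrightarrow> m - w0 \<bullet> w0 / 2"
    by (intro tendsto_intros w0) auto
  then have "(\<lambda>n. snd (p n)) \<longlonglongrightarrow> m - w0 \<bullet> w0 / 2"
    by (simp add: V_def)
  then have "p \<longlonglongrightarrow> (w0, m - w0 \<bullet> w0 / 2)"
    using tendsto_Pair[OF w0] by fastforce
  then have in_E: "(w0, m - w0 \<bullet> w0 / 2) \<in> E" (is "(_, ?r0) \<in> E")
    using \<open>closed E\<close> pE closed_sequentially by blast
  \<comment> \<open>The minimum is compared with the values on the segment towards \<open>(w, r)\<close>; its slope at \<open>w0\<close> is nonnegative.\<close>
  have "?r0 + w0 \<bullet> w0 \<le> r + w0 \<bullet> w" if wr: "(w, r) \<in> E" for w r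
  proof -
    define d where "d = (w - w0) \<bullet> (w - w0) / 2"
    have slope: "0 \<le> r - ?r0 + w0 \<bullet> (w - w0) + t * d" if t: "0 < t" "t \<le> 1" for t
    proof -
      have "(1 - t) *\<^sub>R (w0, ?r0) + t *\<^sub>R (w, r) \<in> E"
        using convexD[OF \<open>convex E\<close> in_E wr, of "1 - t" t] t by auto
      from m_le[OF this]
      have "0 \<le> t * (r - ?r0 + w0 \<bullet> (w - w0) + t * d)"
        by (simp add: V_def d_def inner_add_left inner_add_right inner_diff_left inner_diff_right
            inner_commute algebra_simps add_divide_distrib diff_divide_distrib)
      then show ?thesis using t by (simp add: zero_le_mult_iff)
    qed
    have "((\<lambda>t. r - ?r0 + w0 \<bullet> (w - w0) + t * d) \<longlongrightarrow> r - ?r0 + w0 \<bullet> (w - w0) + 0 * d) (at_right 0)"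
      by (intro tendsto_intros)
    moreover have "\<forall>\<^sub>F t in at_right 0. 0 \<le> r - ?r0 + w0 \<bullet> (w - w0) + t * d"
      using slope unfolding eventually_at_right_field by (intro exI[of _ 1]) auto
    ultimately have "0 \<le> r - ?r0 + w0 \<bullet> (w - w0) + 0 * d"
      by (rule tendsto_lowerbound) simp
    then show ?thesis by (simp add: inner_diff_right)
  qed
  with in_E show thesis by (rule that)
qed

text \<open>
  Let \<open>F(x, u)\<close> be the supremum of \<open>x \<bullet> b + a \<bullet> u - a \<bullet> b\<close> over \<open>(a, b) \<in> G\<close> (the Fitzpatrick function).
  Maximality gives \<open>F(x, u) \<ge> x \<bullet> u\<close>. Let \<open>(x, u)\<close> minimise \<open>F\<close> plus half the squared norm. Testing its
  optimality against the points of \<open>G\<close>, where \<open>F(a, b) = a \<bullet> b\<close>, gives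
  \<open>\<parallel>x + u\<parallel>\<^sup>2 \<le> (- u - a) \<bullet> (- x - b)\<close> for all \<open>(a, b) \<in> G\<close>. So \<open>(- u, - x)\<close> belongs to \<open>G\<close> by
  maximality, and inserting this very point for \<open>(a, b)\<close> forces \<open>x = - u\<close>.
\<close>
lemma minty_graph:
  fixes G :: "('a::{real_inner,complete_space} \<times> 'a) set"
  assumes mono: "\<And>a b c d. (a, b) \<in> G \<Longrightarrow> (c, d) \<in> G \<Longrightarrow> 0 \<le> (a - c) \<bullet> (b - d)"
    and maximal: "\<And>a b. (\<And>c d. (c, d) \<in> G \<Longrightarrow> 0 \<le> (a - c) \<bullet> (b - d)) \<Longrightarrow> (a, b) \<in> G"
  shows "\<exists>y. (y, - y) \<in> G"
proof -
  \<comment> \<open>The epigraph of the Fitzpatrick function.\<close>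
  define E where "E = {(w, r). \<forall>(a, b)\<in>G. w \<bullet> (b, a) - a \<bullet> b \<le> r}"
  have E_eq: "E = (\<Inter>g\<in>G. {p. fst p \<bullet> (snd g, fst g) - fst g \<bullet> snd g \<le> snd p})"
    by (fastforce simp: E_def)
  have "closed E"
    unfolding E_eq by (intro closed_INT ballI closed_Collect_le continuous_intros)
  moreover have "convex E"
    unfolding E_eq
  proof (intro convex_INT)
    fix g :: "'a \<times> 'a"
    have "{p. fst p \<bullet> (snd g, fst g) - fst g \<bullet> snd g \<le> snd p}
        = {p. p \<bullet> ((snd g, fst g), -1 :: real) \<le> fst g \<bullet> snd g}"
      by (auto simp: inner_prod_def)
    then show "convex {p. fst p \<bullet> (snd g, fst g) - fst g \<bullet> snd g \<le> snd p}"
      using convex_halfspace_le[of "((snd g, fst g), -1 :: real)" "fst g \<bullet> snd g"]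
      by (simp add: inner_commute)
  qed
  moreover have "E \<noteq> {}"
  proof -
    obtain a0 b0 where ab0: "(a0, b0) \<in> G" using maximal by (metis)
    have "((a0, b0), a0 \<bullet> b0) \<in> E"
      using mono[OF ab0] unfolding E_def
      by (force simp: inner_diff_left inner_diff_right inner_commute)
    then show ?thesis by blast
  qed
  moreover have coupling: "fst w \<bullet> snd w \<le> r" if "(w, r) \<in> E" for w r
  proof (rule ccontr)
    assume less: "\<not> fst w \<bullet> snd w \<le> r"
    have "w \<in> G"
    proof (cases w)
      case (Pair a b)
      show ?thesis unfolding Pair
      proof (rule maximal)
        fix c d assume "(c, d) \<in> G"
        then have "w \<bullet> (d, c) - c \<bullet> d \<le> r" using that by (auto simp: E_def)
        then show "0 \<le> (a - c) \<bullet> (b - d)"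
          using less Pair by (simp add: inner_diff_left inner_diff_right inner_commute)
      qed
    qed
    then show False
      using that less unfolding E_def
      by (cases w) (force simp: inner_commute)
  qed
  have square: "(a + b) \<bullet> (a + b) = 2 * (a \<bullet> b) + (a, b) \<bullet> (a, b)" for a b :: 'a
    by (simp add: inner_add_left inner_add_right inner_commute)
  moreover have "0 \<le> r + w \<bullet> w / 2" if "(w, r) \<in> E" for w r
    using coupling[OF that] square[of "fst w" "snd w"] inner_ge_zero[of "fst w + snd w"]
    by simp
  ultimately obtain w0 r0 where w0: "(w0, r0) \<in> E"
    and opt: "\<And>w r. (w, r) \<in> E \<Longrightarrow> r0 + w0 \<bullet> w0 \<le> r + w0 \<bullet> w"
    using regularised_epigraph_minimiser[of E] by blast
  obtain x u where xu: "w0 = (x, u)" by (cases w0)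
  have gap: "(x + u) \<bullet> (x + u) \<le> (- u - a) \<bullet> (- x - b)" if "(a, b) \<in> G" for a b
  proof -
    have "((a, b), a \<bullet> b) \<in> E"
      using mono[OF that] unfolding E_def
      by (force simp: inner_diff_left inner_diff_right inner_commute)
    from opt[OF this] coupling[OF w0] show ?thesis
      by (simp add: xu inner_add_left inner_add_right inner_diff_left inner_diff_right
          inner_commute)
  qed
  have mem: "(- u, - x) \<in> G"
    by (rule maximal) (use gap order_trans[OF inner_ge_zero] in blast)
  have "(x + u) \<bullet> (x + u) = 0"
    using gap[OF mem] inner_ge_zero[of "x + u"] by simp
  then have "x = - u" by (simp add: eq_neg_iff_add_eq_0)
  with mem have "(x, - x) \<in> G" by simp
  then show ?thesis ..
qed

text \<open>Translation by \<open>x\<close> and scaling by \<open>l\<close> preserve the hypotheses on the graph in \<open>minty_graph\<close>.\<close>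
corollary resolvent_exists:
  fixes A :: "'a::{real_inner,complete_space} \<Rightarrow> 'a set"
  assumes A: "maximally_monotone A" and l: "l > 0"
  shows "\<exists>y u. u \<in> A y \<and> x = y + l *\<^sub>R u"
proof -
  define G where "G = {(y, l *\<^sub>R u - x) | y u. u \<in> A y}"
  have scale: "(a - c) \<bullet> (l *\<^sub>R b - x - (l *\<^sub>R d - x)) = l * ((a - c) \<bullet> (b - d))" for a b c d :: 'a
    by (simp add: scaleR_diff_right[symmetric])
  have "\<exists>y. (y, - y) \<in> G"
  proof (rule minty_graph)
    fix a b c d assume "(a, b) \<in> G" "(c, d) \<in> G"
    then show "0 \<le> (a - c) \<bullet> (b - d)"
      unfolding G_def
      by (clarify, unfold scale) (use maximally_monotoneD[OF A] l in simp)
  next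
    fix a b assume rel: "\<And>c d. (c, d) \<in> G \<Longrightarrow> 0 \<le> (a - c) \<bullet> (b - d)"
    define b' where "b' = (1 / l) *\<^sub>R (b + x)"
    have b: "b = l *\<^sub>R b' - x" using l by (simp add: b'_def)
    have "b' \<in> A a"
    proof (rule maximally_monotone_memI[OF A])
      fix y v assume "v \<in> A y"
      then have "(y, l *\<^sub>R v - x) \<in> G" by (auto simp: G_def)
      from rel[OF this] show "0 \<le> (a - y) \<bullet> (b' - v)"
        using l unfolding b scale by (simp add: zero_le_mult_iff)
    qed
    then show "(a, b) \<in> G" unfolding G_def b by blast
  qed
  then obtain y u where "u \<in> A y" "- y = l *\<^sub>R u - x" by (auto simp: G_def)
  then show ?thesis by (metis add.commute diff_add_cancel diff_minus_eq_add add_diff_cancel_left')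
qed

lemma resolvent_unique:
  assumes A: "maximally_monotone A" and l: "l > 0"
    and "u \<in> A y" "v \<in> A y'" and eq: "y + l *\<^sub>R u = y' + l *\<^sub>R v"
  shows "y = y'"
proof -
  have "y - y' = - l *\<^sub>R (u - v)" using eq by (simp add: algebra_simps)
  then have "(y - y') \<bullet> (y - y') = - l * ((y - y') \<bullet> (u - v))"
    by (metis inner_scaleR_right)
  also have "\<dots> \<le> 0" using maximally_monotoneD[OF A assms(3,4)] l by simp
  finally show ?thesis by (metis eq_iff_diff_eq_0 inner_eq_zero_iff inner_ge_zero order_antisym)
qed

lemma yosida_resolvent:
  fixes A :: "'a::{real_inner,complete_space} \<Rightarrow> 'a set"
  assumes A: "maximally_monotone A" and l: "l > 0"
  shows "yosida l A x \<in> A (resolvent l A x)"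
    and "x = resolvent l A x + l *\<^sub>R yosida l A x"
proof -
  obtain y u where yu: "u \<in> A y" "x = y + l *\<^sub>R u" using resolvent_exists[OF A l] by blast
  have "resolvent l A x = y"
    unfolding resolvent_def op_inverse_def
    by (rule the_equality) (use yu resolvent_unique[OF A l] in auto)
  then show "yosida l A x \<in> A (resolvent l A x)" "x = resolvent l A x + l *\<^sub>R yosida l A x"
    using yu l by (auto simp: yosida_def)
qed


section \<open>Barbalat's argument in logarithmic time\<close>

text \<open>
  If \<open>D t \<ge> e\<close>, then the Lipschitz bound in \<open>ln t\<close> keeps \<open>D \<ge> e / 2\<close> on \<open>[t, q t]\<close> with a factor \<open>q > 1\<close>
  that depends on \<open>e\<close> and \<open>C\<close> alone. On that interval \<open>W\<close> drops by a fixed amount, which can happen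
  only finitely often because \<open>W\<close> is nonincreasing and bounded below.
\<close>
lemma log_lipschitz_tendsto_0:
  fixes W D :: "real \<Rightarrow> real"
  assumes "t0 > 0" "c > 0" "C > 0"
    and der: "\<And>t. t > t0 \<Longrightarrow> (W has_real_derivative W' t) (at t)"
    and decay: "\<And>t. t > t0 \<Longrightarrow> W' t \<le> - c * (D t)\<^sup>2 / t"
    and W_nonneg: "\<And>t. t > t0 \<Longrightarrow> 0 \<le> W t"
    and D_nonneg: "\<And>t. 0 \<le> D t"
    and lip: "\<And>s t. t0 < s \<Longrightarrow> s \<le> t \<Longrightarrow> \<bar>D t - D s\<bar> \<le> C * (ln t - ln s)"
  shows "(D \<longlongrightarrow> 0) at_top"
proof -
  define L where "L = Inf (W ` {t0<..})"
  have bdd: "bdd_below (W ` {t0<..})"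
    using W_nonneg by (intro bdd_belowI[of _ 0]) auto
  have L_le: "L \<le> W t" if "t > t0" for t
    unfolding L_def using bdd that by (intro cINF_lower) auto
  have anti: "W t \<le> W s" if "t0 < s" "s \<le> t" for s t
  proof (rule DERIV_nonpos_imp_nonincreasing[OF \<open>s \<le> t\<close>])
    fix r assume "s \<le> r" "r \<le> t"
    then have "r > t0" using that by simp
    moreover have "0 \<le> c * (D r)\<^sup>2 / r" using \<open>c > 0\<close> \<open>r > t0\<close> \<open>t0 > 0\<close> by simp
    then have "W' r \<le> 0" using decay[OF \<open>r > t0\<close>] by simp
    ultimately show "\<exists>y. (W has_real_derivative y) (at r) \<and> y \<le> 0" using der by blast
  qed
  show ?thesis
  proof (rule tendstoI)
    fix e :: real assume "0 < e"
    \<comment> \<open>Multiplying time by \<open>q\<close> changes \<open>D\<close> by at most \<open>C * ln q = e / 2\<close>.\<close>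
    define q where "q = exp (e / (2 * C))"
    define k where "k = c * (e / 2)\<^sup>2"
    have q: "q > 1" "ln q = e / (2 * C)" using \<open>0 < e\<close> \<open>C > 0\<close> by (auto simp: q_def)
    have "k > 0" using \<open>0 < e\<close> \<open>c > 0\<close> by (simp add: k_def)
    have "L < L + k * ln q" using \<open>k > 0\<close> q \<open>0 < e\<close> \<open>C > 0\<close> by simp
    then obtain T where T: "T > t0" "W T < L + k * ln q"
      using cInf_lessD[of "W ` {t0<..}" "L + k * ln q"] unfolding L_def by auto
    have "D t < e" if "t \<ge> T" for t
    proof (rule ccontr)
      assume "\<not> D t < e"
      have t: "t > t0" "t > 0" using that T \<open>t0 > 0\<close> by auto
      have "t \<le> q * t" using q t by simp
      have "W (q * t) + k * ln (q * t) \<le> W t + k * ln t"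
      proof (rule DERIV_nonpos_imp_nonincreasing[OF \<open>t \<le> q * t\<close>])
        fix r assume r: "t \<le> r" "r \<le> q * t"
        then have "r > t0" "r > 0" using t by auto
        have "ln r \<le> ln (q * t)" using r \<open>r > 0\<close> by simp
        then have "ln r - ln t \<le> e / (2 * C)" using q t by (simp add: ln_mult)
        then have "C * (ln r - ln t) \<le> C * (e / (2 * C))" using \<open>C > 0\<close> by (intro mult_left_mono) auto
        then have "\<bar>D r - D t\<bar> \<le> e / 2" using lip[of t r] t r \<open>C > 0\<close> by simp
        then have "e / 2 \<le> D r" using \<open>\<not> D t < e\<close> by linarith
        then have "k \<le> c * (D r)\<^sup>2"
          unfolding k_def using \<open>c > 0\<close> \<open>0 < e\<close> by (intro mult_left_mono power_mono) auto
        then have "k / r \<le> c * (D r)\<^sup>2 / r" using \<open>r > 0\<close> by (intro divide_right_mono) auto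
        then have "W' r + k * (1 / r) \<le> 0" using decay[OF \<open>r > t0\<close>] by simp
        moreover have "((\<lambda>r. W r + k * ln r) has_real_derivative W' r + k * (1 / r)) (at r)"
          using der[OF \<open>r > t0\<close>] \<open>r > 0\<close> by (auto intro!: derivative_eq_intros)
        ultimately show "\<exists>y. ((\<lambda>r. W r + k * ln r) has_real_derivative y) (at r) \<and> y \<le> 0" by blast
      qed
      then have "W (q * t) + k * ln q \<le> W t" using q t by (simp add: ln_mult distrib_left)
      moreover have "L \<le> W (q * t)" using L_le[of "q * t"] t \<open>t \<le> q * t\<close> by simp
      moreover have "W t \<le> W T" using anti[OF T(1) that] .
      ultimately show False using T by simp
    qed
    then show "\<forall>\<^sub>F t in at_top. dist (D t) 0 < e"
      using D_nonneg unfolding eventually_at_top_linorder by (intro exI[of _ T]) (simp add: dist_real_def)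
  qed
qed

section \<open>The energy of a trajectory\<close>

text \<open>
  Here \<open>y\<close> stands for \<open>x(t) - z\<close> and \<open>p\<close> for \<open>x'(t)\<close>. The first two terms are \<open>t h' + (\<alpha> - 1) h\<close> with
  \<open>h = \<parallel>x - z\<parallel>\<^sup>2 / 2\<close>, a primitive of \<open>t h'' + \<alpha> h'\<close>. The last one absorbs the mixed term
  \<open>x' \<bullet> x''\<close> that appears when \<open>\<lambda> \<parallel>u\<parallel>\<^sup>2\<close> is expanded with the differential equation.
\<close>
definition energy :: "real \<Rightarrow> real \<Rightarrow> real \<Rightarrow> 'a::real_inner \<Rightarrow> 'a \<Rightarrow> real" where
  "energy \<alpha> \<kappa> t y p = t * (y \<bullet> p) + (\<alpha> - 1) / 2 * (y \<bullet> y) + \<kappa> * t\<^sup>2 * (p \<bullet> p)"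

text \<open>Completing the square in \<open>y\<close>.\<close>
lemma energy_lower_bound:
  assumes "\<alpha> > 1"
  shows "(\<kappa> - 1 / (2 * (\<alpha> - 1))) * (t\<^sup>2 * (p \<bullet> p)) \<le> energy \<alpha> \<kappa> t y p"
proof -
  define b where "b = \<alpha> - 1"
  have "b > 0" using assms by (simp add: b_def)
  have "0 \<le> b / 2 * ((y + (t / b) *\<^sub>R p) \<bullet> (y + (t / b) *\<^sub>R p))"
    using \<open>b > 0\<close> by simp
  also have "\<dots> = b / 2 * (y \<bullet> y) + t * (y \<bullet> p) + 1 / (2 * b) * (t\<^sup>2 * (p \<bullet> p))"
    using \<open>b > 0\<close>
    by (simp add: inner_add_left inner_add_right inner_commute field_simps power2_eq_square)
  finally show ?thesis unfolding energy_def b_def[symmetric] by (simp add: algebra_simps)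
qed

text \<open>
  The differential equation removes the second derivative, and the damping cancels every
  \<open>y \<bullet> p\<close> term; this cancellation is what fixes the coefficient \<open>(\<alpha> - 1) / 2\<close>.
\<close>
lemma energy_has_derivative:
  assumes "(x has_vector_derivative x' t) (at t)" "(x' has_vector_derivative x'') (at t)"
    and "t \<noteq> 0" and eq: "x'' = - u - (\<alpha> / t) *\<^sub>R x' t"
  shows "((\<lambda>t. energy \<alpha> \<kappa> t (x t - z) (x' t)) has_real_derivative
      (1 + 2 * \<kappa> - 2 * \<kappa> * \<alpha>) * t * (x' t \<bullet> x' t) - 2 * \<kappa> * t\<^sup>2 * (x' t \<bullet> u) - t * ((x t - z) \<bullet> u)) (at t)"
proof -
  note inner_deriv = bounded_bilinear.has_vector_derivative[OF bounded_bilinear_inner,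
      folded has_real_derivative_iff_has_vector_derivative]
  have y: "((\<lambda>t. x t - z) has_vector_derivative x' t) (at t)"
    using assms(1) by (auto intro!: derivative_eq_intros)
  note d = inner_deriv[OF y assms(2)] inner_deriv[OF y y] inner_deriv[OF assms(2,2)]
  show ?thesis
    unfolding energy_def
    by (rule derivative_eq_intros d refl)+
      (use \<open>t \<noteq> 0\<close> in \<open>simp add: eq inner_diff_right inner_diff_left inner_commute field_simps power2_eq_square\<close>)
qed

text \<open>
  With \<open>\<lambda> = \<kappa> t\<^sup>2 / \<alpha>\<close> the coercivity term \<open>t \<lambda> \<parallel>u\<parallel>\<^sup>2\<close> completes the mixed term
  \<open>2 \<kappa> t\<^sup>2 (p \<bullet> u)\<close> to the square \<open>\<kappa> \<alpha> t \<parallel>p + (t / \<alpha>) u\<parallel>\<^sup>2\<close>.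
\<close>
lemma energy_dissipation:
  fixes p u :: "'a::real_inner"
  assumes "t > 0" "\<alpha> > 0"
    and coercive: "\<nu> * d\<^sup>2 + (\<kappa> * t\<^sup>2 / \<alpha>) * (u \<bullet> u) \<le> yu"
  shows "(1 + 2 * \<kappa> - 2 * \<kappa> * \<alpha>) * t * (p \<bullet> p) - 2 * \<kappa> * t\<^sup>2 * (p \<bullet> u) - t * yu
    \<le> - (t * (\<nu> * d\<^sup>2 + (\<kappa> * \<alpha> - 1 - 2 * \<kappa>) * (norm p)\<^sup>2 + \<kappa> * \<alpha> * (norm (p + (t / \<alpha>) *\<^sub>R u))\<^sup>2))"
proof -
  have "t * (\<nu> * d\<^sup>2 + (\<kappa> * t\<^sup>2 / \<alpha>) * (u \<bullet> u)) \<le> t * yu"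
    using coercive \<open>t > 0\<close> by (intro mult_left_mono) auto
  moreover define N where "N = (norm (p + (t / \<alpha>) *\<^sub>R u))\<^sup>2"
  have "\<kappa> * \<alpha> * N = \<kappa> * \<alpha> * (p \<bullet> p) + 2 * \<kappa> * t * (p \<bullet> u) + (\<kappa> * t\<^sup>2 / \<alpha>) * (u \<bullet> u)"
    unfolding N_def power2_norm_eq_inner using \<open>\<alpha> > 0\<close>
    by (simp add: inner_add_left inner_add_right inner_commute field_simps power2_eq_square)
  then have "t * (\<kappa> * \<alpha> * N)
      = t * (\<kappa> * \<alpha> * (p \<bullet> p) + 2 * \<kappa> * t * (p \<bullet> u) + (\<kappa> * t\<^sup>2 / \<alpha>) * (u \<bullet> u))"
    by simp
  ultimately show ?thesis
    using \<open>\<alpha> > 0\<close> unfolding N_def[symmetric] power2_norm_eq_inner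
    by (simp add: algebra_simps power2_eq_square inner_commute[of u p])
qed

lemma square_add_le: "(a + b)\<^sup>2 \<le> 2 * a\<^sup>2 + 2 * (b::real)\<^sup>2"
  using zero_le_power2[of "a - b"] by (simp add: power2_sum power2_diff)

lemma norm_log_lipschitz:
  fixes x :: "real \<Rightarrow> 'a::real_normed_vector"
  assumes "t0 > 0"
    and der: "\<And>t. t > t0 \<Longrightarrow> (x has_vector_derivative x' t) (at t)"
    and bound: "\<And>t. t > t0 \<Longrightarrow> t * norm (x' t) \<le> C"
    and "t0 < s" "s \<le> t"
  shows "norm (x t - x s) \<le> C * (ln t - ln s)"
proof (cases "s = t")
  case False
  have "norm (x t - x s) \<le> C * ln t - C * ln s"
  proof (rule differentiable_bound_general)
    show "s < t" using False assms by simp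
    show "continuous_on {s..t} x"
      using der \<open>t0 < s\<close>
      by (intro continuous_at_imp_continuous_on ballI has_vector_derivative_continuous[OF der]) simp
    show "continuous_on {s..t} (\<lambda>r. C * ln r)"
      using \<open>t0 < s\<close> \<open>t0 > 0\<close> by (intro continuous_intros) auto
    fix r assume r: "s < r" "r < t"
    then have "r > t0" "r > 0" using assms by auto
    show "(x has_vector_derivative x' r) (at r)" using der[OF \<open>r > t0\<close>] .
    show "((\<lambda>r. C * ln r) has_vector_derivative C / r) (at r)"
      unfolding has_real_derivative_iff_has_vector_derivative[symmetric]
      using \<open>r > 0\<close> by (auto intro!: derivative_eq_intros)
    show "norm (x' r) \<le> C / r" using bound[OF \<open>r > t0\<close>] \<open>r > 0\<close> by (simp add: field_simps)
  qed
  then show ?thesis by (simp add: algebra_simps)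
qed simp

section \<open>Convergence of the distance to the zeros\<close>

theorem theorem5p1:
  fixes A :: "'a::{real_inner, complete_space} \<Rightarrow> 'a set"
    and x :: "real \<Rightarrow> 'a"
    and \<nu> t0 \<alpha> \<epsilon> :: real
  assumes "maximally_monotone A"
    and "zeros A \<noteq> {}"
    and "\<nu> > 0"
    and "\<And>y u z. u \<in> A y \<Longrightarrow> z \<in> zeros A \<Longrightarrow> u \<bullet> (y - z) \<ge> \<nu> * (infdist y (zeros A))\<^sup>2"
    and "t0 > 0"
    and "\<alpha> > 2"
    and "\<epsilon> > 2 / (\<alpha> - 2)"
    and "classical_solution t0 \<alpha> (\<lambda>t. (1 + \<epsilon>) * (t\<^sup>2 / \<alpha>\<^sup>2)) A x"
  shows "((\<lambda>t. infdist (x t) (zeros A)) \<longlongrightarrow> 0) at_top \<and>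
         (\<forall>zbar. zeros A = {zbar} \<longrightarrow> (x \<longlongrightarrow> zbar) at_top)"
proof -
  define \<kappa> where "\<kappa> = (1 + \<epsilon>) / \<alpha>"
  define \<delta> where "\<delta> = \<kappa> * \<alpha> - 1 - 2 * \<kappa>"
  define \<sigma> where "\<sigma> = \<kappa> - 1 / (2 * (\<alpha> - 1))"
  define l where "l t = (1 + \<epsilon>) * (t\<^sup>2 / \<alpha>\<^sup>2)" for t
  have "1 + \<epsilon> > \<alpha> / (\<alpha> - 2)"
    using assms(6,7) by (simp add: field_simps)
  then have \<kappa>_gt: "\<kappa> > 1 / (\<alpha> - 2)"
    using assms(6) by (simp add: \<kappa>_def field_simps)
  then have "\<kappa> > 0" using assms(6) by (smt (verit) divide_pos_pos)
  have "\<delta> > 0" using \<kappa>_gt assms(6) by (simp add: \<delta>_def field_simps)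
  have "1 / (2 * (\<alpha> - 1)) \<le> 1 / (\<alpha> - 2)" using assms(6) by (intro divide_left_mono) auto
  then have "\<sigma> > 0" using \<kappa>_gt by (simp add: \<sigma>_def)
  have "\<alpha> > 0" using assms(6) by simp
  have l: "l t = \<kappa> * t\<^sup>2 / \<alpha>" for t
    using \<open>\<alpha> > 0\<close> by (simp add: l_def \<kappa>_def power2_eq_square)

  obtain x' x'' where
    der_within: "\<And>t. t \<ge> t0 \<Longrightarrow> (x has_vector_derivative x' t) (at t within {t0..})"
      "\<And>t. t \<ge> t0 \<Longrightarrow> (x' has_vector_derivative x'' t) (at t within {t0..})"
    and ode: "\<And>t. t \<ge> t0 \<Longrightarrow> x'' t + (\<alpha> / t) *\<^sub>R x' t + yosida (l t) A (x t) = 0"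
    using assms(8) unfolding classical_solution_def l_def by blast
  have at_eq: "at t within {t0..} = at t" if "t > t0" for t :: real
    using that by (intro at_within_interior) simp
  have der: "(x has_vector_derivative x' t) (at t)" "(x' has_vector_derivative x'' t) (at t)"
    if "t > t0" for t
    using der_within[of t] that at_eq by auto

  obtain z where z: "z \<in> zeros A" using assms(2) by blast
  define u where "u t = yosida (l t) A (x t)" for t
  define d where "d t = infdist (resolvent (l t) A (x t)) (zeros A)" for t
  define D where "D t = infdist (x t) (zeros A)" for t
  define W where "W t = energy \<alpha> \<kappa> t (x t - z) (x' t)" for t
  define W' where "W' t = (1 + 2 * \<kappa> - 2 * \<kappa> * \<alpha>) * t * (x' t \<bullet> x' t)
    - 2 * \<kappa> * t\<^sup>2 * (x' t \<bullet> u t) - t * ((x t - z) \<bullet> u t)" for t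
  have W_der: "(W has_real_derivative W' t) (at t)" if "t > t0" for t
  proof -
    have "x'' t = - u t - (\<alpha> / t) *\<^sub>R x' t"
      using ode[of t] that unfolding u_def
      by (metis add.commute add_diff_cancel_right' diff_0 diff_diff_add less_imp_le)
    then show ?thesis
      unfolding W_def W'_def using energy_has_derivative der[OF that] that assms(5) by fastforce
  qed

  \<comment> \<open>The first bound on \<open>c\<close> pays for \<open>2 dist(J,S)\<^sup>2\<close>, using \<open>t \<ge> t0\<close>. The second pays for
    \<open>2 \<lambda>\<^sup>2 \<parallel>u\<parallel>\<^sup>2\<close>, which is at most \<open>4 \<kappa>\<^sup>2 t\<^sup>2\<close> times the sum of the two squares in the dissipation.\<close>
  define c where "c = min (\<nu> * t0\<^sup>2 / 2) (min \<delta> (\<kappa> * \<alpha>) / (4 * \<kappa>\<^sup>2))"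
  have "c > 0"
    using assms(3,5) \<open>\<delta> > 0\<close> \<open>\<kappa> > 0\<close> \<open>\<alpha> > 0\<close> by (simp add: c_def)
  have "min \<delta> (\<kappa> * \<alpha>) / (4 * \<kappa>\<^sup>2) \<le> \<delta> / (4 * \<kappa>\<^sup>2)"
    "min \<delta> (\<kappa> * \<alpha>) / (4 * \<kappa>\<^sup>2) \<le> \<kappa> * \<alpha> / (4 * \<kappa>\<^sup>2)"
    by (auto intro!: divide_right_mono)
  then have "c \<le> \<nu> * t0\<^sup>2 / 2" "c \<le> \<delta> / (4 * \<kappa>\<^sup>2)" "c \<le> \<kappa> * \<alpha> / (4 * \<kappa>\<^sup>2)"
    unfolding c_def by linarith+
  then have c_le: "2 * c \<le> \<nu> * t0\<^sup>2" "4 * \<kappa>\<^sup>2 * c \<le> \<delta>" "4 * \<kappa>\<^sup>2 * c \<le> \<kappa> * \<alpha>"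
    using \<open>\<kappa> > 0\<close> by (auto simp: field_simps)

  have decay: "W' t \<le> - c * (D t)\<^sup>2 / t" if "t > t0" for t
  proof -
    have "t > 0" using that assms(5) by simp
    have "l t > 0" using \<open>t > 0\<close> \<open>\<kappa> > 0\<close> \<open>\<alpha> > 0\<close> by (simp add: l)
    note yos = yosida_resolvent[OF assms(1) \<open>l t > 0\<close>, of "x t"]
    define J where "J = resolvent (l t) A (x t)"
    have u_mem: "u t \<in> A J" and x_eq: "x t = J + l t *\<^sub>R u t"
      using yos by (auto simp: u_def J_def)
    define P where "P = (norm (x' t))\<^sup>2"
    define Q where "Q = (norm (x' t + (t / \<alpha>) *\<^sub>R u t))\<^sup>2"
    have PQ: "P \<ge> 0" "Q \<ge> 0" by (auto simp: P_def Q_def)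
    have "(x t - z) \<bullet> u t = u t \<bullet> (J - z) + l t * (u t \<bullet> u t)"
      by (simp add: x_eq inner_diff_left inner_diff_right inner_add_left inner_add_right inner_commute)
    then have "\<nu> * (d t)\<^sup>2 + (\<kappa> * t\<^sup>2 / \<alpha>) * (u t \<bullet> u t) \<le> (x t - z) \<bullet> u t"
      using assms(4)[OF u_mem z] by (simp add: d_def J_def l)
    from energy_dissipation[OF \<open>t > 0\<close> \<open>\<alpha> > 0\<close> this]
    have W'_le: "W' t \<le> - (t * (\<nu> * (d t)\<^sup>2 + \<delta> * P + \<kappa> * \<alpha> * Q))"
      unfolding W'_def \<delta>_def P_def Q_def .

    have "D t \<le> d t + norm (l t *\<^sub>R u t)"
    proof -
      have "dist (x t) J = norm (l t *\<^sub>R u t)" by (simp add: dist_norm x_eq)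
      then show ?thesis
        using infdist_triangle[of "x t" "zeros A" J] unfolding D_def d_def J_def by simp
    qed
    then have "(D t)\<^sup>2 \<le> (d t + norm (l t *\<^sub>R u t))\<^sup>2"
      by (intro power_mono) (auto simp: D_def infdist_nonneg)
    also have "\<dots> \<le> 2 * (d t)\<^sup>2 + 2 * (norm (l t *\<^sub>R u t))\<^sup>2" by (rule square_add_le)
    finally have D_le: "(D t)\<^sup>2 \<le> 2 * (d t)\<^sup>2 + 2 * (norm (l t *\<^sub>R u t))\<^sup>2" .
    \<comment> \<open>As \<open>\<lambda> u = \<kappa> t (t / \<alpha>) u\<close>, it is controlled by the two vectors whose squares \<open>W'\<close> dissipates.\<close>
    have "l t *\<^sub>R u t = (\<kappa> * t) *\<^sub>R ((x' t + (t / \<alpha>) *\<^sub>R u t) - x' t)"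
      by (simp add: l power2_eq_square)
    then have "(norm (l t *\<^sub>R u t))\<^sup>2
        = (\<kappa> * t)\<^sup>2 * (norm ((x' t + (t / \<alpha>) *\<^sub>R u t) - x' t))\<^sup>2"
      by (metis norm_scaleR power2_abs power_mult_distrib)
    also have "\<dots> \<le> (\<kappa> * t)\<^sup>2 * (norm (x' t + (t / \<alpha>) *\<^sub>R u t) + norm (x' t))\<^sup>2"
      by (intro mult_left_mono power_mono norm_triangle_ineq4) auto
    also have "\<dots> \<le> (\<kappa> * t)\<^sup>2 * (2 * Q + 2 * P)"
      unfolding P_def Q_def by (intro mult_left_mono square_add_le) auto
    finally have lu_le: "(norm (l t *\<^sub>R u t))\<^sup>2 \<le> (\<kappa> * t)\<^sup>2 * (2 * Q + 2 * P)" .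
    have "c * (D t)\<^sup>2 \<le> c * (2 * (d t)\<^sup>2 + 2 * ((\<kappa> * t)\<^sup>2 * (2 * Q + 2 * P)))"
      using D_le lu_le \<open>c > 0\<close> by (intro mult_left_mono) auto
    also have "\<dots> = (2 * c) * (d t)\<^sup>2 + t\<^sup>2 * ((4 * \<kappa>\<^sup>2 * c) * P + (4 * \<kappa>\<^sup>2 * c) * Q)"
      by (simp add: algebra_simps power_mult_distrib)
    also have "\<dots> \<le> (\<nu> * t\<^sup>2) * (d t)\<^sup>2 + t\<^sup>2 * (\<delta> * P + \<kappa> * \<alpha> * Q)"
    proof (intro add_mono mult_left_mono mult_right_mono c_le PQ)
      have "\<nu> * t0\<^sup>2 \<le> \<nu> * t\<^sup>2"
        using that assms(3,5) by (intro mult_left_mono power_mono) auto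
      then show "2 * c \<le> \<nu> * t\<^sup>2" using c_le(1) by simp
    qed auto
    also have "\<dots> = t * (t * (\<nu> * (d t)\<^sup>2 + \<delta> * P + \<kappa> * \<alpha> * Q))"
      by (simp add: algebra_simps power2_eq_square)
    finally have "c * (D t)\<^sup>2 / t \<le> t * (\<nu> * (d t)\<^sup>2 + \<delta> * P + \<kappa> * \<alpha> * Q)"
      using \<open>t > 0\<close> by (simp add: divide_le_eq mult.commute)
    then show ?thesis using W'_le by simp
  qed

  have W_lower: "\<sigma> * (t * norm (x' t))\<^sup>2 \<le> W t" for t
    using energy_lower_bound[of \<alpha> \<kappa> t "x' t" "x t - z"] assms(6)
    by (simp add: W_def \<sigma>_def power_mult_distrib power2_norm_eq_inner)
  have W_nonneg: "0 \<le> W t" for t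
    using W_lower[of t] \<open>\<sigma> > 0\<close> by (smt (verit) mult_nonneg_nonneg zero_le_power2)

  \<comment> \<open>Two-sided derivatives exist only after \<open>t0\<close>, so the energy is compared with its value at a later time.\<close>
  define t1 where "t1 = t0 + 1"
  have t1: "t1 > 0" "t1 > t0" using assms(5) by (auto simp: t1_def)
  have W_anti: "W t \<le> W t1" if "t1 \<le> t" for t
  proof (rule DERIV_nonpos_imp_nonincreasing[OF that])
    fix r assume "t1 \<le> r"
    then have "r > t0" "r > 0" using t1 by auto
    have "0 \<le> c * (D r)\<^sup>2 / r" using \<open>c > 0\<close> \<open>r > 0\<close> by simp
    then have "W' r \<le> 0" using decay[OF \<open>r > t0\<close>] by simp
    then show "\<exists>y. (W has_real_derivative y) (at r) \<and> y \<le> 0" using W_der[OF \<open>r > t0\<close>] by blast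
  qed
  define C where "C = sqrt (W t1 / \<sigma>) + 1"
  have "C > 0" using W_nonneg[of t1] \<open>\<sigma> > 0\<close> by (simp add: C_def add_nonneg_pos)
  have speed: "t * norm (x' t) \<le> C" if "t > t1" for t
  proof -
    have "(t * norm (x' t))\<^sup>2 \<le> W t1 / \<sigma>"
      using W_lower[of t] W_anti[of t] that \<open>\<sigma> > 0\<close> by (simp add: pos_le_divide_eq mult.commute)
    then show ?thesis using real_le_rsqrt by (force simp: C_def)
  qed
  have D_lip: "\<bar>D t - D s\<bar> \<le> C * (ln t - ln s)" if "t1 < s" "s \<le> t" for s t
  proof -
    have "\<bar>D t - D s\<bar> \<le> norm (x t - x s)"
      unfolding D_def using infdist_triangle_abs[of "x t" "zeros A" "x s"] by (simp add: dist_norm)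
    also have "\<dots> \<le> C * (ln t - ln s)"
      using norm_log_lipschitz[OF t1(1) der(1) speed that] t1 by simp
    finally show ?thesis .
  qed
  have "(D \<longlongrightarrow> 0) at_top"
    by (rule log_lipschitz_tendsto_0[OF t1(1) \<open>c > 0\<close> \<open>C > 0\<close> W_der decay W_nonneg _ D_lip])
      (use t1 in \<open>auto simp: D_def infdist_nonneg\<close>)
  then have lim: "((\<lambda>t. infdist (x t) (zeros A)) \<longlongrightarrow> 0) at_top"
    unfolding D_def .
  moreover have "(x \<longlongrightarrow> zbar) at_top" if "zeros A = {zbar}" for zbar
    using lim unfolding that tendsto_dist_iff[of x] by (simp add: infdist_singleton)
  ultimately show ?thesis by blast
qed

end
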